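(* Let $\gamma\ge1$. Let $\{a_n\}_{n\in\mathbb Z}$ with $a_n>0$ and $\{b_n\}_{n\in\mathbb Z}$ with $b_n\in\mathbb R$ be sequences such that $\{b_n\},\{a_n-1\}\in\ell^{\gamma+1/2}(\mathbb Z)$. Let $W$ be the Jacobi operator on $\ell^2(\mathbb Z)$ $$Wu(n)=a_{n-1}u(n-1)+b_nu(n)+a_nu(n+1),\qquad n\in\mathbb Z,$$ whose essential spectrum is $[-2,2]$, and let $E_1^+>E_2^+>\dots>2$ and $E_1^-<E_2^-<\dots<-2$ be its (simple) eigenvalues outside $[-2,2]$. Then $$\sum_j |E_j^-+2|^\gamma+\sum_j|E_j^+-2|^\gamma\le 3^{\gamma-1/2}\,\frac{\pi}{\sqrt3}\,L^{cl}_{\gamma,1}\Big(\sum_{n\in\mathbb Z}|b_n|^{\gamma+1/2}+4\sum_{n\in\mathbb Z}|a_n-1|^{\gamma+1/2}\Big),$$ where $L^{cl}_{\gamma,1}=\dfrac{\Gamma(\gamma+1)}{2\sqrt\pi\,\Gamma(\gamma+3/2)}$. *)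

theory Defs
  imports "HOL-Analysis.Analysis"
begin

definition jacobi_op :: "(int \<Rightarrow> real) \<Rightarrow> (int \<Rightarrow> real) \<Rightarrow> (int \<Rightarrow> complex) \<Rightarrow> int \<Rightarrow> complex" where
  "jacobi_op a b u n =
     of_real (a (n - 1)) * u (n - 1) + of_real (b n) * u n + of_real (a n) * u (n + 1)"

definition ell2_int :: "(int \<Rightarrow> complex) \<Rightarrow> bool" where
  "ell2_int u \<longleftrightarrow> (\<lambda>n. (norm (u n))\<^sup>2) summable_on UNIV"

definition jacobi_eigenvalue :: "(int \<Rightarrow> real) \<Rightarrow> (int \<Rightarrow> real) \<Rightarrow> real \<Rightarrow> bool" where
  "jacobi_eigenvalue a b E \<longleftrightarrow>
     (\<exists>u. ell2_int u \<and> u \<noteq> (\<lambda>_. 0) \<and> (\<forall>n. jacobi_op a b u n = of_real E * u n))"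

definition L_cl :: "real \<Rightarrow> real" where
  "L_cl \<gamma> = Gamma (\<gamma> + 1) / (2 * sqrt pi * Gamma (\<gamma> + 3 / 2))"

end

theory Submission
  imports Defs
begin

text \<open>The Jacobi form is dominated by the discrete Schroedinger form with potential
  \<open>V n = max (b n) 0 + \<bar>a n - 1\<bar> + \<bar>a (n - 1) - 1\<bar>\<close> (Hundertmark--Simon). For orthonormal
  eigenfunctions with density \<open>\<rho>\<close>, the discrete Agmon inequality yields
  \<open>\<Sum> \<rho> ^ 3 \<le> \<Sum> \<parallel>D \<psi>\<parallel>\<^sup>2\<close> (Eden--Foias), so the eigenvalues with \<open>E - 2 > t\<close> satisfy
  \<open>\<Sum> (E - 2 - t) \<le> \<Sum> ((V - t) \<rho> - \<rho> ^ 3)\<close>, which is maximised pointwise in \<open>\<rho>\<close>. Applying this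
  at every level \<open>t\<close> to the eigenfunctions of the Jacobi operator itself avoids the min-max
  principle, and integrating against \<open>t powr (\<gamma> - 2)\<close> (Aizenman--Lieb) gives the exponent \<open>\<gamma>\<close>.
  The conjugation \<open>u n \<mapsto> (-1) ^ n * u n\<close> exchanges the two ends of the spectrum.\<close>

section \<open>Square-summable real sequences and their inner product\<close>

definition l2 :: "(int \<Rightarrow> real) \<Rightarrow> bool" where
  "l2 u \<longleftrightarrow> (\<lambda>n. (u n)\<^sup>2) summable_on UNIV"

definition ip :: "(int \<Rightarrow> real) \<Rightarrow> (int \<Rightarrow> real) \<Rightarrow> real" where
  "ip u v = (\<Sum>\<^sub>\<infinity>n. u n * v n)"

definition fdiff :: "(int \<Rightarrow> real) \<Rightarrow> int \<Rightarrow> real" where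
  "fdiff u n = u (n + 1) - u n"

lemma bij_shift: "bij (\<lambda>n::int. n + c)"
  by (rule bij_plus_right)

lemma has_sum_shift:
  fixes f :: "int \<Rightarrow> real"
  shows "((\<lambda>n. f (n + c)) has_sum S) UNIV \<longleftrightarrow> (f has_sum S) UNIV"
  by (rule has_sum_reindex_bij_betw[OF bij_shift])

lemma l2_mult_summable:
  assumes "l2 u" "l2 v"
  shows "(\<lambda>n. u n * v n) summable_on UNIV"
proof -
  have "(\<lambda>n. (u n)\<^sup>2 + (v n)\<^sup>2) summable_on UNIV"
    using assms unfolding l2_def by (rule summable_on_add)
  moreover have "\<bar>u n * v n\<bar> \<le> (u n)\<^sup>2 + (v n)\<^sup>2" for n
  proof -
    have "0 \<le> (\<bar>u n\<bar> - \<bar>v n\<bar>)\<^sup>2" by simp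
    then have "2 * (\<bar>u n\<bar> * \<bar>v n\<bar>) \<le> (u n)\<^sup>2 + (v n)\<^sup>2"
      by (simp add: power2_diff)
    moreover have "0 \<le> \<bar>u n\<bar> * \<bar>v n\<bar>" by simp
    ultimately show ?thesis unfolding abs_mult by linarith
  qed
  ultimately have "(\<lambda>n. norm (u n * v n)) summable_on UNIV"
    by (intro summable_on_comparison_test[where g = "\<lambda>n. norm (u n * v n)"]) auto
  then show ?thesis by (rule abs_summable_summable)
qed

lemma l2_mult_has_sum: "l2 u \<Longrightarrow> l2 v \<Longrightarrow> ((\<lambda>n. u n * v n) has_sum ip u v) UNIV"
  unfolding ip_def by (intro has_sum_infsum l2_mult_summable)

lemma ip_eqI: "((\<lambda>n. u n * v n) has_sum S) UNIV \<Longrightarrow> ip u v = S"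
  unfolding ip_def by (rule infsumI)

lemma ip_self_nonneg: "ip u u \<ge> 0"
  unfolding ip_def by (rule infsum_nonneg) simp

lemma l2_add:
  assumes "l2 u" "l2 v"
  shows "l2 (\<lambda>n. u n + v n)"
proof -
  have "(\<lambda>n. (u n)\<^sup>2 + (v n)\<^sup>2 + 2 * (u n * v n)) summable_on UNIV"
    using assms by (intro summable_on_add summable_on_cmult_right l2_mult_summable)
      (auto simp: l2_def)
  then show ?thesis by (simp add: l2_def power2_sum mult.assoc)
qed

lemma l2_bounded_mult:
  assumes "l2 u" "\<And>n. \<bar>w n\<bar> \<le> K"
  shows "l2 (\<lambda>n. w n * u n)"
proof -
  have "(\<lambda>n. K\<^sup>2 * (u n)\<^sup>2) summable_on UNIV"
    using assms(1) unfolding l2_def by (rule summable_on_cmult_right)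
  moreover have "(w n * u n)\<^sup>2 \<le> K\<^sup>2 * (u n)\<^sup>2" for n
  proof -
    have "\<bar>w n\<bar>\<^sup>2 \<le> K\<^sup>2" using assms(2)[of n] by (intro power_mono) auto
    then show ?thesis by (simp add: power_mult_distrib mult_right_mono)
  qed
  ultimately show ?thesis unfolding l2_def by (rule summable_on_comparison_test) auto
qed

lemma l2_scale: "l2 u \<Longrightarrow> l2 (\<lambda>n. c * u n)"
  by (rule l2_bounded_mult[where K = "\<bar>c\<bar>"]) auto

lemma l2_zero: "l2 (\<lambda>n. 0)"
  by (simp add: l2_def)

lemma l2_sum:
  assumes "finite F" "\<And>i. i \<in> F \<Longrightarrow> l2 (f i)"
  shows "l2 (\<lambda>n. \<Sum>i\<in>F. f i n)"
  using assms by (induction F rule: finite_induct) (auto intro: l2_zero l2_add)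

lemma l2_shift: "l2 u \<Longrightarrow> l2 (\<lambda>n. u (n + c))"
  unfolding l2_def using summable_on_reindex_bij_betw[OF bij_shift, of "\<lambda>n. (u n)\<^sup>2"] by blast

lemma l2_fdiff: "l2 u \<Longrightarrow> l2 (fdiff u)"
  using l2_add[OF l2_shift[of u 1] l2_scale[of u "-1"]] by (simp add: fdiff_def[abs_def])

lemma has_sum_sum:
  fixes f :: "'i \<Rightarrow> 'a \<Rightarrow> real"
  assumes "finite F" "\<And>i. i \<in> F \<Longrightarrow> ((f i) has_sum s i) A"
  shows "((\<lambda>x. \<Sum>i\<in>F. f i x) has_sum (\<Sum>i\<in>F. s i)) A"
  using assms by (induction F rule: finite_induct) (auto intro: has_sum_add)

lemma ip_sum_sum:
  assumes "finite F" "\<And>i. i \<in> F \<Longrightarrow> l2 (f i)"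
  shows "ip (\<lambda>n. \<Sum>i\<in>F. c i * f i n) (\<lambda>n. \<Sum>i\<in>F. c i * f i n)
    = (\<Sum>i\<in>F. \<Sum>j\<in>F. c i * c j * ip (f i) (f j))"
proof (rule ip_eqI)
  have "((\<lambda>n. \<Sum>i\<in>F. \<Sum>j\<in>F. c i * c j * (f i n * f j n)) has_sum
      (\<Sum>i\<in>F. \<Sum>j\<in>F. c i * c j * ip (f i) (f j))) UNIV"
    using assms by (intro has_sum_sum has_sum_cmult_right l2_mult_has_sum)
  then show "((\<lambda>n. (\<Sum>i\<in>F. c i * f i n) * (\<Sum>i\<in>F. c i * f i n)) has_sum
      (\<Sum>i\<in>F. \<Sum>j\<in>F. c i * c j * ip (f i) (f j))) UNIV"
    by (simp add: sum_product mult_ac)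
qed

lemma L2_set_le_sqrt_ip:
  assumes "l2 u" "finite K"
  shows "L2_set u K \<le> sqrt (ip u u)"
proof -
  have "(\<Sum>n\<in>K. (u n)\<^sup>2) \<le> (\<Sum>\<^sub>\<infinity>n. (u n)\<^sup>2)"
    using assms by (intro finite_sum_le_infsum) (auto simp: l2_def)
  then show ?thesis by (simp add: L2_set_def ip_def power2_eq_square)
qed

lemma sum_abs_mult_le_ip:
  assumes "l2 u" "l2 v" "finite K"
  shows "(\<Sum>n\<in>K. \<bar>u n\<bar> * \<bar>v n\<bar>) \<le> sqrt (ip u u) * sqrt (ip v v)"
proof -
  have "(\<Sum>n\<in>K. \<bar>u n\<bar> * \<bar>v n\<bar>) \<le> L2_set u K * L2_set v K" by (rule L2_set_mult_ineq)
  also have "\<dots> \<le> sqrt (ip u u) * sqrt (ip v v)"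
    using assms by (intro mult_mono L2_set_le_sqrt_ip) (auto simp: ip_self_nonneg)
  finally show ?thesis .
qed

section \<open>The discrete Agmon inequality and its version for orthonormal families\<close>

lemma l2_small_along:
  assumes "l2 u" "inj g" "e > 0"
  obtains i :: nat where "(u (g i))\<^sup>2 < e"
proof -
  have "(\<lambda>n. (u n)\<^sup>2) summable_on range g"
    using assms(1) unfolding l2_def by (rule summable_on_subset) auto
  then have "(\<lambda>i. (u (g i))\<^sup>2) summable_on UNIV"
    using assms(2) by (simp add: summable_on_reindex o_def)
  then have "(\<lambda>i. (u (g i))\<^sup>2) \<longlonglongrightarrow> 0"
    by (intro summable_LIMSEQ_zero summable_on_imp_summable)
  then have "\<forall>\<^sub>F i in sequentially. (u (g i))\<^sup>2 < e"
    using assms(3) by (rule order_tendstoD)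
  then show ?thesis using that by (auto dest: eventually_happens)
qed

lemma square_diff_le_fdiff:
  "\<bar>(u (n + 1))\<^sup>2 - (u n)\<^sup>2\<bar> \<le> \<bar>fdiff u n\<bar> * (\<bar>u n\<bar> + \<bar>u (n + 1)\<bar>)"
proof -
  have "(u (n + 1))\<^sup>2 - (u n)\<^sup>2 = fdiff u n * (u n + u (n + 1))"
    by (simp add: fdiff_def algebra_simps power2_eq_square)
  then show ?thesis by (simp add: abs_mult mult_left_mono abs_triangle_ineq)
qed

text \<open>The increments of \<open>u\<^sup>2\<close> are telescoped from far left up to
  \<open>n\<close> and from \<open>n\<close> out to far right. Averaging the two estimates, instead
  of using one side alone, halves the bound and gives the constant 1.\<close>

lemma discrete_agmon:
  assumes u: "l2 u"
  shows "(u n) ^ 4 \<le> ip u u * ip (fdiff u) (fdiff u)"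
proof -
  define h where "h k = \<bar>fdiff u k\<bar> * (\<bar>u k\<bar> + \<bar>u (k + 1)\<bar>)" for k
  define M where "M = sqrt (ip u u) * sqrt (ip (fdiff u) (fdiff u))"
  have h0: "h k \<ge> 0" for k by (simp add: h_def)
  have left: "(u n)\<^sup>2 \<le> (u (n - int i))\<^sup>2 + (\<Sum>k\<in>{n - int i..<n}. h k)" for i
  proof (induction i)
    case (Suc i)
    have "{n - int (Suc i)..<n} = insert (n - int (Suc i)) {n - int i..<n}" by auto
    then have "(\<Sum>k\<in>{n - int (Suc i)..<n}. h k) = h (n - int (Suc i)) + (\<Sum>k\<in>{n - int i..<n}. h k)"
      by simp
    moreover have "(u (n - int i))\<^sup>2 \<le> (u (n - int (Suc i)))\<^sup>2 + h (n - int (Suc i))"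
      using square_diff_le_fdiff[of u "n - int (Suc i)"] by (simp add: h_def)
    ultimately show ?case using Suc by linarith
  qed simp
  have right: "(u n)\<^sup>2 \<le> (u (n + int i))\<^sup>2 + (\<Sum>k\<in>{n..<n + int i}. h k)" for i
  proof (induction i)
    case (Suc i)
    have "{n..<n + int (Suc i)} = insert (n + int i) {n..<n + int i}" by auto
    then have "(\<Sum>k\<in>{n..<n + int (Suc i)}. h k) = h (n + int i) + (\<Sum>k\<in>{n..<n + int i}. h k)"
      by simp
    moreover have "(u (n + int i))\<^sup>2 \<le> (u (n + int (Suc i)))\<^sup>2 + h (n + int i)"
      using square_diff_le_fdiff[of u "n + int i"] by (simp add: h_def add_ac)
    ultimately show ?case using Suc by linarith
  qed simp
  have shift: "ip (\<lambda>k. u (k + 1)) (\<lambda>k. u (k + 1)) = ip u u"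
    by (rule ip_eqI) (use has_sum_shift[of "\<lambda>k. u k * u k"] l2_mult_has_sum[OF u u] in blast)
  \<comment> \<open>Cauchy-Schwarz is applied to the \<open>u k\<close> half and the
    \<open>u (k + 1)\<close> half of \<open>h\<close> separately; by \<open>shift\<close> both
    halves have the same bound \<open>M\<close>.\<close>
  have hsum: "(\<Sum>k\<in>K. h k) \<le> 2 * M" if "finite K" for K
  proof -
    have "(\<Sum>k\<in>K. h k) = (\<Sum>k\<in>K. \<bar>u k\<bar> * \<bar>fdiff u k\<bar>) + (\<Sum>k\<in>K. \<bar>u (k + 1)\<bar> * \<bar>fdiff u k\<bar>)"
      by (simp add: h_def algebra_simps sum.distrib)
    also have "\<dots> \<le> M + M"
      unfolding M_def
      using sum_abs_mult_le_ip[OF u l2_fdiff[OF u] that]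
        sum_abs_mult_le_ip[OF l2_shift[OF u] l2_fdiff[OF u] that, of 1]
      by (intro add_mono) (auto simp: shift)
    finally show ?thesis by simp
  qed
  have "(u n)\<^sup>2 \<le> M + e" if e: "e > 0" for e
  proof -
    \<comment> \<open>Square-summability makes the squared value at some endpoint on each side
      smaller than \<open>e\<close>, so the boundary terms of the telescoping sums cost at most
      \<open>2 * e\<close>.\<close>
    obtain i where i: "(u (n - int i))\<^sup>2 < e"
      using l2_small_along[OF u _ e, of "\<lambda>i. n - int i"] by (auto simp: inj_def)
    obtain j where j: "(u (n + int j))\<^sup>2 < e"
      using l2_small_along[OF u _ e, of "\<lambda>i. n + int i"] by (auto simp: inj_def)
    \<comment> \<open>The two ranges are disjoint, so the left and right estimates together use each
      bond at most once and \<open>hsum\<close> is needed only once for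
      \<open>2 * (u n)\<^sup>2\<close>.\<close>
    have "(\<Sum>k\<in>{n - int i..<n}. h k) + (\<Sum>k\<in>{n..<n + int j}. h k)
        = (\<Sum>k\<in>{n - int i..<n} \<union> {n..<n + int j}. h k)"
      by (subst sum.union_disjoint) auto
    also have "\<dots> \<le> 2 * M" by (rule hsum) auto
    finally show ?thesis using left[of i] right[of j] i j by linarith
  qed
  then have "(u n)\<^sup>2 \<le> M" by (rule field_le_epsilon)
  then have "((u n)\<^sup>2)\<^sup>2 \<le> M\<^sup>2" by (intro power_mono) auto
  then show ?thesis by (simp add: M_def power_mult_distrib ip_self_nonneg)
qed

text \<open>For fixed \<open>n\<close>, apply the Agmon inequality at \<open>n\<close> to the combination of the \<open>\<psi> i\<close> with
  coefficients \<open>\<psi> i n\<close>, and sum over \<open>n\<close>.\<close>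

lemma orthonormal_kinetic_bound:
  assumes fin: "finite F" and l2: "\<And>i. i \<in> F \<Longrightarrow> l2 (\<psi> i)"
    and orth: "\<And>i j. i \<in> F \<Longrightarrow> j \<in> F \<Longrightarrow> ip (\<psi> i) (\<psi> j) = (if i = j then 1 else 0)"
  shows "(\<lambda>n. (\<Sum>i\<in>F. (\<psi> i n)\<^sup>2) ^ 3) summable_on UNIV"
    and "(\<Sum>\<^sub>\<infinity>n. (\<Sum>i\<in>F. (\<psi> i n)\<^sup>2) ^ 3) \<le> (\<Sum>i\<in>F. ip (fdiff (\<psi> i)) (fdiff (\<psi> i)))"
proof -
  define \<rho> where "\<rho> n = (\<Sum>i\<in>F. (\<psi> i n)\<^sup>2)" for n
  define G where
    "G n = (\<Sum>i\<in>F. \<Sum>j\<in>F. \<psi> i n * \<psi> j n * ip (fdiff (\<psi> i)) (fdiff (\<psi> j)))" for n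
  have \<rho>0: "\<rho> n \<ge> 0" for n by (simp add: \<rho>_def sum_nonneg)
  have le: "\<rho> n ^ 3 \<le> G n" for n
  proof -
    define u where "u = (\<lambda>k. \<Sum>i\<in>F. \<psi> i n * \<psi> i k)"
    have u: "l2 u" unfolding u_def using fin l2 by (intro l2_sum l2_scale)
    have fd: "fdiff u = (\<lambda>k. \<Sum>i\<in>F. \<psi> i n * fdiff (\<psi> i) k)"
      by (simp add: fun_eq_iff u_def fdiff_def sum_subtractf algebra_simps)
    have "ip u u = (\<Sum>i\<in>F. \<Sum>j\<in>F. \<psi> i n * \<psi> j n * ip (\<psi> i) (\<psi> j))"
      unfolding u_def using fin l2 by (rule ip_sum_sum)
    also have "\<dots> = (\<Sum>i\<in>F. \<Sum>j\<in>F. if i = j then \<psi> i n * \<psi> j n else 0)"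
      by (intro sum.cong refl) (simp add: orth)
    also have "\<dots> = \<rho> n" using fin by (simp add: \<rho>_def power2_eq_square)
    finally have uu: "ip u u = \<rho> n" .
    have dd: "ip (fdiff u) (fdiff u) = G n"
      unfolding fd G_def using fin l2 by (intro ip_sum_sum l2_fdiff)
    have "u n = \<rho> n" by (simp add: u_def \<rho>_def power2_eq_square)
    \<comment> \<open>The coefficients \<open>\<psi> i n\<close> are chosen so that both
      \<open>u n\<close> and \<open>ip u u\<close> equal \<open>\<rho> n\<close>. One factor
      \<open>\<rho> n\<close> then cancels, and where \<open>\<rho> n = 0\<close> the nonnegativity
      of \<open>G n\<close> suffices.\<close>
    then have *: "\<rho> n ^ 4 \<le> \<rho> n * G n" using discrete_agmon[OF u, of n] by (simp add: uu dd)
    have G0: "G n \<ge> 0" using ip_self_nonneg[of "fdiff u"] by (simp add: dd)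
    show ?thesis
    proof (cases "\<rho> n = 0")
      case False
      then have "\<rho> n > 0" using \<rho>0[of n] by simp
      moreover have "\<rho> n * \<rho> n ^ 3 \<le> \<rho> n * G n" using * by (simp add: eval_nat_numeral)
      ultimately show ?thesis by simp
    qed (use G0 in simp)
  qed
  \<comment> \<open>Summing over sites turns the products \<open>\<psi> i n * \<psi> j n\<close>
    into inner products, so orthonormality leaves only the diagonal kinetic energies.\<close>
  have "(G has_sum (\<Sum>i\<in>F. \<Sum>j\<in>F. ip (\<psi> i) (\<psi> j) * ip (fdiff (\<psi> i)) (fdiff (\<psi> j)))) UNIV"
    unfolding G_def using fin l2 by (intro has_sum_sum has_sum_cmult_left l2_mult_has_sum)
  also have "(\<Sum>i\<in>F. \<Sum>j\<in>F. ip (\<psi> i) (\<psi> j) * ip (fdiff (\<psi> i)) (fdiff (\<psi> j)))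
      = (\<Sum>i\<in>F. \<Sum>j\<in>F. if i = j then ip (fdiff (\<psi> i)) (fdiff (\<psi> j)) else 0)"
    by (intro sum.cong refl) (simp add: orth)
  also have "\<dots> = (\<Sum>i\<in>F. ip (fdiff (\<psi> i)) (fdiff (\<psi> i)))" using fin by simp
  finally have G: "(G has_sum (\<Sum>i\<in>F. ip (fdiff (\<psi> i)) (fdiff (\<psi> i)))) UNIV" .
  have sm: "(\<lambda>n. \<rho> n ^ 3) summable_on UNIV"
    by (rule summable_on_comparison_test[OF has_sum_imp_summable[OF G]]) (auto simp: le \<rho>0)
  then show "(\<lambda>n. (\<Sum>i\<in>F. (\<psi> i n)\<^sup>2) ^ 3) summable_on UNIV" by (simp add: \<rho>_def)
  have "(\<Sum>\<^sub>\<infinity>n. \<rho> n ^ 3) \<le> (\<Sum>i\<in>F. ip (fdiff (\<psi> i)) (fdiff (\<psi> i)))"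
    by (rule has_sum_mono[OF has_sum_infsum[OF sm] G]) (rule le)
  then show "(\<Sum>\<^sub>\<infinity>n. (\<Sum>i\<in>F. (\<psi> i n)\<^sup>2) ^ 3) \<le> (\<Sum>i\<in>F. ip (fdiff (\<psi> i)) (fdiff (\<psi> i)))"
    by (simp add: \<rho>_def)
qed

section \<open>The quadratic form of the Jacobi operator on eigenfunctions\<close>

text \<open>The bond joining \<open>n\<close> and \<open>n + 1\<close> charges its defect
  \<open>\<bar>a n - 1\<bar>\<close> to both of its ends, so each site pays for two bonds. Only the
  positive part of \<open>b\<close> can raise the upper end of the spectrum.\<close>

definition majorant :: "(int \<Rightarrow> real) \<Rightarrow> (int \<Rightarrow> real) \<Rightarrow> int \<Rightarrow> real" where
  "majorant a b n = max (b n) 0 + \<bar>a n - 1\<bar> + \<bar>a (n - 1) - 1\<bar>"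

lemma majorant_nonneg: "majorant a b n \<ge> 0"
  by (simp add: majorant_def)

definition eigenfunction :: "(int \<Rightarrow> real) \<Rightarrow> (int \<Rightarrow> real) \<Rightarrow> real \<Rightarrow> (int \<Rightarrow> real) \<Rightarrow> bool" where
  "eigenfunction a b E u \<longleftrightarrow>
     l2 u \<and> (\<forall>n. a (n - 1) * u (n - 1) + b n * u n + a n * u (n + 1) = E * u n)"

text \<open>Split \<open>a = 1 + (a - 1)\<close>. The free part is the identity 2xy = x^2 + y^2 - (y
  - x)^2, and the defect part follows from 2|xy| \<le> x^2 + y^2.\<close>

lemma bond_le:
  fixes a x y :: real
  shows "2 * (a * (x * y)) \<le> \<bar>a - 1\<bar> * x\<^sup>2 + \<bar>a - 1\<bar> * y\<^sup>2 + x\<^sup>2 + y\<^sup>2 - (y - x)\<^sup>2"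
proof -
  have "2 * \<bar>x * y\<bar> \<le> x\<^sup>2 + y\<^sup>2"
    using zero_le_power2[of "\<bar>x\<bar> - \<bar>y\<bar>"] by (simp add: power2_diff abs_mult)
  then have "\<bar>a - 1\<bar> * (2 * \<bar>x * y\<bar>) \<le> \<bar>a - 1\<bar> * (x\<^sup>2 + y\<^sup>2)"
    by (rule mult_left_mono) simp
  moreover have "(a - 1) * (x * y) \<le> \<bar>a - 1\<bar> * \<bar>x * y\<bar>"
    by (metis abs_ge_self abs_mult)
  ultimately show ?thesis by (simp add: algebra_simps power2_eq_square)
qed

lemma l2_weighted_summable:
  assumes "l2 u" "l2 v" "\<And>n. \<bar>w n\<bar> \<le> K"
  shows "(\<lambda>n. w n * (u n * v n)) summable_on UNIV"
  using l2_mult_summable[OF l2_bounded_mult[OF assms(1,3)] assms(2)] by (simp add: mult.assoc)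

text \<open>Pair the eigenvalue equation with \<open>u\<close> and apply \<open>bond_le\<close> on
  every bond. Boundedness of the coefficients makes each of the sums converge, so they may be
  shifted and recombined separately.\<close>

lemma eigenfunction_form_le:
  assumes u: "eigenfunction a b E u"
    and a: "\<And>n. \<bar>a n - 1\<bar> \<le> K" and b: "\<And>n. \<bar>b n\<bar> \<le> K"
  shows "E * ip u u \<le> (\<Sum>\<^sub>\<infinity>n. majorant a b n * (u n)\<^sup>2) + 2 * ip u u - ip (fdiff u) (fdiff u)"
proof -
  have l2u: "l2 u" and eq: "\<And>n. a (n - 1) * u (n - 1) + b n * u n + a n * u (n + 1) = E * u n"
    using u by (auto simp: eigenfunction_def)
  note sh = l2_shift[OF l2u, of 1]
  have a': "\<bar>a n\<bar> \<le> K + 1" for n using a[of n] by linarith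
  have b': "\<bar>max (b n) 0\<bar> \<le> K" for n using b[of n] by linarith
  have a1: "\<bar>\<bar>a n - 1\<bar>\<bar> \<le> K" for n using a[of n] by simp
  obtain SA where SA: "((\<lambda>n. a n * (u n * u (n + 1))) has_sum SA) UNIV"
    using l2_weighted_summable[where w = a, OF l2u sh a'] by (auto simp: summable_on_def)
  obtain SB where SB: "((\<lambda>n. b n * (u n * u n)) has_sum SB) UNIV"
    using l2_weighted_summable[where w = b, OF l2u l2u b] by (auto simp: summable_on_def)
  obtain P where P: "((\<lambda>n. max (b n) 0 * (u n * u n)) has_sum P) UNIV"
    using l2_weighted_summable[where w = "\<lambda>n. max (b n) 0", OF l2u l2u b'] by (auto simp: summable_on_def)
  obtain Q where Q: "((\<lambda>n. \<bar>a n - 1\<bar> * (u n * u n)) has_sum Q) UNIV"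
    using l2_weighted_summable[where w = "\<lambda>n. \<bar>a n - 1\<bar>", OF l2u l2u a1] by (auto simp: summable_on_def)
  obtain R where R: "((\<lambda>n. \<bar>a n - 1\<bar> * (u (n + 1) * u (n + 1))) has_sum R) UNIV"
    using l2_weighted_summable[where w = "\<lambda>n. \<bar>a n - 1\<bar>", OF sh sh a1] by (auto simp: summable_on_def)
  \<comment> \<open>Translation invariance identifies the two hopping sums, and \<open>R'\<close>
    moves the defect charged to the right end of a bond back to the site \<open>n\<close>, giving
    the third term of \<open>majorant\<close>.\<close>
  have SA': "((\<lambda>n. a (n - 1) * (u (n - 1) * u n)) has_sum SA) UNIV"
    using SA has_sum_shift[of "\<lambda>n. a n * (u n * u (n + 1))" "-1"] by simp
  have R': "((\<lambda>n. \<bar>a (n - 1) - 1\<bar> * (u n * u n)) has_sum R) UNIV"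
    using R has_sum_shift[of "\<lambda>n. \<bar>a n - 1\<bar> * (u (n + 1) * u (n + 1))" "-1"] by simp
  note N = l2_mult_has_sum[OF l2u l2u]
  have N': "((\<lambda>n. u (n + 1) * u (n + 1)) has_sum ip u u) UNIV"
    using N has_sum_shift[of "\<lambda>n. u n * u n" 1] by simp
  note D = l2_mult_has_sum[OF l2_fdiff[OF l2u] l2_fdiff[OF l2u]]
  have "((\<lambda>n. a (n - 1) * (u (n - 1) * u n) + b n * (u n * u n) + a n * (u n * u (n + 1)))
      has_sum (SA + SB + SA)) UNIV"
    by (intro has_sum_add SA SA' SB)
  moreover have "a (n - 1) * (u (n - 1) * u n) + b n * (u n * u n) + a n * (u n * u (n + 1))
      = E * (u n * u n)" for n
    using arg_cong[OF eq[of n], of "\<lambda>x. x * u n"] by (simp add: algebra_simps)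
  ultimately have "((\<lambda>n. E * (u n * u n)) has_sum (SA + SB + SA)) UNIV" by simp
  then have E: "E * ip u u = SA + SB + SA"
    using has_sum_cmult_right[OF N, of E] has_sum_unique by blast
  have "((\<lambda>n. max (b n) 0 * (u n * u n) + \<bar>a n - 1\<bar> * (u n * u n) + \<bar>a (n - 1) - 1\<bar> * (u n * u n))
      has_sum (P + Q + R)) UNIV"
    by (intro has_sum_add P Q R')
  then have V: "(\<Sum>\<^sub>\<infinity>n. majorant a b n * (u n)\<^sup>2) = P + Q + R"
    by (intro infsumI) (simp add: majorant_def algebra_simps power2_eq_square)
  have "2 * SA + SB + ip (fdiff u) (fdiff u) \<le> P + Q + R + ip u u + ip u u"
  proof (rule has_sum_mono)
    show "((\<lambda>n. 2 * (a n * (u n * u (n + 1))) + b n * (u n * u n) + fdiff u n * fdiff u n)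
        has_sum (2 * SA + SB + ip (fdiff u) (fdiff u))) UNIV"
      by (intro has_sum_add has_sum_cmult_right SA SB D)
    show "((\<lambda>n. max (b n) 0 * (u n * u n) + \<bar>a n - 1\<bar> * (u n * u n)
        + \<bar>a n - 1\<bar> * (u (n + 1) * u (n + 1)) + u n * u n + u (n + 1) * u (n + 1))
        has_sum (P + Q + R + ip u u + ip u u)) UNIV"
      by (intro has_sum_add P Q R N N')
    fix n
    have "b n * (u n * u n) \<le> max (b n) 0 * (u n * u n)" by (rule mult_right_mono) auto
    then show "2 * (a n * (u n * u (n + 1))) + b n * (u n * u n) + fdiff u n * fdiff u n
      \<le> max (b n) 0 * (u n * u n) + \<bar>a n - 1\<bar> * (u n * u n)
        + \<bar>a n - 1\<bar> * (u (n + 1) * u (n + 1)) + u n * u n + u (n + 1) * u (n + 1)"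
      using bond_le[of "a n" "u n" "u (n + 1)"]
      unfolding fdiff_def power2_eq_square by linarith
  qed
  then show ?thesis unfolding V using E by linarith
qed

text \<open>This is symmetry of the operator: in \<open>(W u) v - u (W v)\<close> the diagonal terms
  cancel pointwise, while the hopping terms cancel only after summation, because shifted sums
  agree.\<close>

lemma eigenfunctions_orthogonal:
  assumes u: "eigenfunction a b E u" and v: "eigenfunction a b E' v"
    and a: "\<And>n. \<bar>a n - 1\<bar> \<le> K" and ne: "E \<noteq> E'"
  shows "ip u v = 0"
proof -
  have l2: "l2 u" "l2 v"
    and eq: "\<And>n. a (n - 1) * u (n - 1) + b n * u n + a n * u (n + 1) = E * u n"
      "\<And>n. a (n - 1) * v (n - 1) + b n * v n + a n * v (n + 1) = E' * v n"
    using u v by (auto simp: eigenfunction_def)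
  have a': "\<bar>a n\<bar> \<le> K + 1" for n using a[of n] by linarith
  obtain S where S: "((\<lambda>n. a n * (u (n + 1) * v n)) has_sum S) UNIV"
    using l2_weighted_summable[where w = a, OF l2_shift[OF l2(1), of 1] l2(2) a'] by (auto simp: summable_on_def)
  obtain R where R: "((\<lambda>n. a n * (u n * v (n + 1))) has_sum R) UNIV"
    using l2_weighted_summable[where w = a, OF l2(1) l2_shift[OF l2(2), of 1] a'] by (auto simp: summable_on_def)
  have S': "((\<lambda>n. a (n - 1) * (u n * v (n - 1))) has_sum S) UNIV"
    using S has_sum_shift[of "\<lambda>n. a n * (u (n + 1) * v n)" "-1"] by simp
  have R': "((\<lambda>n. a (n - 1) * (u (n - 1) * v n)) has_sum R) UNIV"
    using R has_sum_shift[of "\<lambda>n. a n * (u n * v (n + 1))" "-1"] by simp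
  have "((\<lambda>n. a n * (u (n + 1) * v n) + a (n - 1) * (u (n - 1) * v n)
      + (- 1) * (a n * (u n * v (n + 1)) + a (n - 1) * (u n * v (n - 1))))
      has_sum (S + R + (- 1) * (R + S))) UNIV"
    by (intro has_sum_add has_sum_cmult_right S S' R R')
  moreover have "a n * (u (n + 1) * v n) + a (n - 1) * (u (n - 1) * v n)
      + (- 1) * (a n * (u n * v (n + 1)) + a (n - 1) * (u n * v (n - 1)))
      = (E - E') * (u n * v n)" for n
    using arg_cong[OF eq(1)[of n], of "\<lambda>x. x * v n"] arg_cong[OF eq(2)[of n], of "\<lambda>x. x * u n"]
    by (simp add: algebra_simps)
  ultimately have "((\<lambda>n. (E - E') * (u n * v n)) has_sum 0) UNIV" by simp
  then have "(E - E') * ip u v = 0"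
    using has_sum_cmult_right[OF l2_mult_has_sum[OF l2]] has_sum_unique by blast
  then show ?thesis using ne by simp
qed

section \<open>The estimate at a fixed level \<open>t\<close>\<close>

lemma cubic_max:
  fixes c x :: real
  assumes "x \<ge> 0"
  shows "c * x - x ^ 3 \<le> 2 / (3 * sqrt 3) * max c 0 powr (3 / 2)"
proof (cases "c > 0")
  case True
  \<comment> \<open>\<open>s\<close> is the critical point of c x - x^3 on the half line. The gap to
    the maximal value 2 s^3 factors as (x - s)^2 (x + 2 s).\<close>
  define s where "s = sqrt (c / 3)"
  have s: "s > 0" "c = 3 * s\<^sup>2" using True by (auto simp: s_def)
  have "0 \<le> (x - s)\<^sup>2 * (x + 2 * s)" using assms s by simp
  then have "c * x - x ^ 3 \<le> 2 * s ^ 3"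
    unfolding s(2) by (simp add: algebra_simps power2_eq_square power3_eq_cube)
  also have "c powr (3 / 2) = c * sqrt c"
    using True powr_add[of c 1 "1/2"] by (simp add: powr_half_sqrt)
  then have "2 * s ^ 3 = 2 / (3 * sqrt 3) * max c 0 powr (3 / 2)"
    using s True by (simp add: real_sqrt_mult power2_eq_square power3_eq_cube)
  finally show ?thesis .
next
  case False
  then have "c * x \<le> 0" using assms by (simp add: mult_nonpos_nonneg)
  moreover have "x ^ 3 \<ge> 0" using assms by simp
  ultimately have "c * x - x ^ 3 \<le> 0" by linarith
  then show ?thesis using False by (simp add: max_def)
qed

text \<open>The sites are split at a finite set \<open>S\<close> so that later only finite sums are
  integrated in \<open>t\<close>. The remainder uses the density of all of \<open>F\<close>, not
  just of the eigenvalues above the level, which makes it independent of \<open>t\<close>.\<close>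

lemma eigenvalue_level_bound:
  assumes fin: "finite F" and ef: "\<And>E. E \<in> F \<Longrightarrow> eigenfunction a b E (\<psi> E)"
    and norm1: "\<And>E. E \<in> F \<Longrightarrow> ip (\<psi> E) (\<psi> E) = 1"
    and a: "\<And>n. \<bar>a n - 1\<bar> \<le> K" and b: "\<And>n. \<bar>b n\<bar> \<le> K"
    and t: "t \<ge> 0" and S: "finite S"
  shows "(\<Sum>E\<in>F. max (E - 2 - t) 0)
    \<le> (\<Sum>n\<in>S. 2 / (3 * sqrt 3) * max (majorant a b n - t) 0 powr (3 / 2))
      + (\<Sum>\<^sub>\<infinity>n\<in>-S. majorant a b n * (\<Sum>E\<in>F. (\<psi> E n)\<^sup>2))"
proof -
  define V where "V = majorant a b"
  define F' where "F' = {E \<in> F. E - 2 > t}"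
  have fin': "finite F'" and sub: "F' \<subseteq> F" using fin by (auto simp: F'_def)
  define \<rho> where "\<rho> n = (\<Sum>E\<in>F. (\<psi> E n)\<^sup>2)" for n
  define \<rho>' where "\<rho>' n = (\<Sum>E\<in>F'. (\<psi> E n)\<^sup>2)" for n
  have V0: "V n \<ge> 0" for n by (simp add: V_def majorant_nonneg)
  have VK: "\<bar>V n\<bar> \<le> 3 * K" for n
    using a[of n] a[of "n - 1"] b[of n] by (simp add: V_def majorant_def)
  have \<rho>'0: "\<rho>' n \<ge> 0" for n by (simp add: \<rho>'_def sum_nonneg)
  have \<rho>'\<rho>: "\<rho>' n \<le> \<rho> n" for n unfolding \<rho>_def \<rho>'_def using fin sub by (intro sum_mono2) auto
  have l2: "l2 (\<psi> E)" if "E \<in> F" for E using ef[OF that] by (simp add: eigenfunction_def)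
  have Vsum: "((\<lambda>n. V n * (\<psi> E n)\<^sup>2) has_sum (\<Sum>\<^sub>\<infinity>n. V n * (\<psi> E n)\<^sup>2)) UNIV" if "E \<in> F" for E
    unfolding power2_eq_square using that
    by (intro has_sum_infsum l2_weighted_summable[where w = V, OF _ _ VK] l2)
  have orth: "ip (\<psi> E) (\<psi> E') = (if E = E' then 1 else 0)" if "E \<in> F'" "E' \<in> F'" for E E'
    using eigenfunctions_orthogonal[OF ef ef a, of E E'] norm1 that sub by auto
  note kin = orthonormal_kinetic_bound[of F' \<psi>, OF fin' l2 orth, folded \<rho>'_def]
  have kin1: "(\<lambda>n. \<rho>' n ^ 3) summable_on UNIV" by (rule kin(1)) (use sub in auto)
  have kin2: "(\<Sum>\<^sub>\<infinity>n. \<rho>' n ^ 3) \<le> (\<Sum>E\<in>F'. ip (fdiff (\<psi> E)) (fdiff (\<psi> E)))"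
    by (rule kin(2)) (use sub in auto)
  have A: "((\<lambda>n. V n * \<rho>' n) has_sum (\<Sum>E\<in>F'. \<Sum>\<^sub>\<infinity>n. V n * (\<psi> E n)\<^sup>2)) UNIV"
    unfolding \<rho>'_def sum_distrib_left by (intro has_sum_sum fin' Vsum) (use sub in auto)
  have B: "(\<rho>' has_sum (\<Sum>E\<in>F'. ip (\<psi> E) (\<psi> E))) UNIV"
    unfolding \<rho>'_def power2_eq_square
    by (intro has_sum_sum fin' l2_mult_has_sum l2) (use sub in auto)
  define X where "X n = V n * \<rho>' n + (- t) * \<rho>' n + (- 1) * \<rho>' n ^ 3" for n
  have X: "(X has_sum ((\<Sum>E\<in>F'. \<Sum>\<^sub>\<infinity>n. V n * (\<psi> E n)\<^sup>2) + (- t) * (\<Sum>E\<in>F'. ip (\<psi> E) (\<psi> E))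
      + (- 1) * (\<Sum>\<^sub>\<infinity>n. \<rho>' n ^ 3))) UNIV"
    unfolding X_def by (intro has_sum_add has_sum_cmult_right A B has_sum_infsum kin1)
  have "(\<Sum>E\<in>F. max (E - 2 - t) 0) = (\<Sum>E\<in>F'. E - 2 - t)"
    using fin by (intro sum.mono_neutral_cong_right) (auto simp: F'_def)
  also have "\<dots> \<le> (\<Sum>E\<in>F'. (\<Sum>\<^sub>\<infinity>n. V n * (\<psi> E n)\<^sup>2) - ip (fdiff (\<psi> E)) (fdiff (\<psi> E)) - t)"
  proof (rule sum_mono)
    fix E assume "E \<in> F'"
    then have "E \<in> F" using sub by auto
    then show "E - 2 - t \<le> (\<Sum>\<^sub>\<infinity>n. V n * (\<psi> E n)\<^sup>2) - ip (fdiff (\<psi> E)) (fdiff (\<psi> E)) - t"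
      using eigenfunction_form_le[OF ef a b, of E] norm1[of E] by (simp add: V_def)
  qed
  \<comment> \<open>\<open>kin2\<close> trades the kinetic energies for the sum of
    \<open>\<rho>' n ^ 3\<close>; what remains is a sum over sites whose term depends on
    \<open>\<rho>'\<close> only through its value at that site.\<close>
  also have "\<dots> \<le> infsum X UNIV"
    using kin2 sub norm1 by (simp add: infsumI[OF X] sum_subtractf subset_iff)
  also have "\<dots> = infsum X (S \<union> - S)" by simp
  also have "\<dots> = sum X S + infsum X (- S)"
    using S summable_on_subset[OF has_sum_imp_summable[OF X]]
    by (subst infsum_Un_disjoint) auto
  \<comment> \<open>On \<open>S\<close> the cubic in \<open>\<rho>' n\<close> is maximised. Off
    \<open>S\<close> the two negative terms are dropped and \<open>\<rho>'\<close> is enlarged to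
    \<open>\<rho>\<close>.\<close>
  also have "\<dots> \<le> (\<Sum>n\<in>S. 2 / (3 * sqrt 3) * max (V n - t) 0 powr (3 / 2))
      + (\<Sum>\<^sub>\<infinity>n\<in>-S. V n * \<rho> n)"
  proof (intro add_mono sum_mono infsum_mono)
    show "X n \<le> 2 / (3 * sqrt 3) * max (V n - t) 0 powr (3 / 2)" for n
      using cubic_max[OF \<rho>'0, of "V n - t" n] by (simp add: X_def algebra_simps)
    show "X summable_on - S" by (rule summable_on_subset[OF has_sum_imp_summable[OF X]]) auto
    have "((\<lambda>n. V n * \<rho> n) has_sum (\<Sum>E\<in>F. \<Sum>\<^sub>\<infinity>n. V n * (\<psi> E n)\<^sup>2)) UNIV"
      unfolding \<rho>_def sum_distrib_left by (intro has_sum_sum fin Vsum)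
    then show "(\<lambda>n. V n * \<rho> n) summable_on - S"
      by (rule summable_on_subset[OF has_sum_imp_summable]) auto
    show "X n \<le> V n * \<rho> n" for n
    proof -
      have "V n * \<rho>' n \<le> V n * \<rho> n" using \<rho>'\<rho> V0 by (intro mult_left_mono)
      moreover have "t * \<rho>' n \<ge> 0" "\<rho>' n ^ 3 \<ge> 0" using t \<rho>'0 by simp_all
      ultimately show ?thesis unfolding X_def by linarith
    qed
  qed
  finally show ?thesis by (simp add: V_def \<rho>_def)
qed

section \<open>Beta integrals and the lifting to the exponent \<open>\<gamma>\<close>\<close>

lemma has_integral_truncated_Beta:
  fixes v T \<alpha> \<beta> :: real
  assumes "\<alpha> > 0" "\<beta> > 0" "0 \<le> v" "v \<le> T"
  shows "((\<lambda>t. t powr (\<alpha> - 1) * max (v - t) 0 powr (\<beta> - 1)) has_integral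
    v powr (\<alpha> + \<beta> - 1) * Beta \<alpha> \<beta>) {0..T}"
proof (cases "v = 0")
  case True
  \<comment> \<open>Both sides vanish by the convention that \<open>0 powr x = 0\<close> for every
    \<open>x\<close>; the same convention makes the integrand zero beyond \<open>v\<close> in the
    other case.\<close>
  have "((\<lambda>t. 0) has_integral (0::real)) {0..T}" by simp
  then show ?thesis
    by (rule has_integral_eq[rotated, THEN has_integral_eq_rhs]) (auto simp: True max_def)
next
  case False
  then have v: "v > 0" using assms by simp
  have img: "(\<lambda>x. x / (1 / v)) ` {0..1} = {0..v}"
    using v image_mult_atLeastAtMost[of v 0 1] by (simp add: mult.commute)
  \<comment> \<open>The Beta integral on the unit interval is rescaled by t = v x; multiplying by
    \<open>v powr (\<alpha> + \<beta> - 2)\<close> then clears the powers of \<open>1 / v\<close> in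
    the integrand.\<close>
  have "((\<lambda>t. (1 / v * t) powr (\<alpha> - 1) * (1 - 1 / v * t) powr (\<beta> - 1)) has_integral v * Beta \<alpha> \<beta>) {0..v}"
    using has_integral_stretch_real[OF has_integral_Beta_real[OF assms(1,2)], of "1 / v"] v
    unfolding img by simp
  then have *: "((\<lambda>t. v powr (\<alpha> + \<beta> - 2) * ((1 / v * t) powr (\<alpha> - 1) * (1 - 1 / v * t) powr (\<beta> - 1)))
      has_integral v powr (\<alpha> + \<beta> - 2) * (v * Beta \<alpha> \<beta>)) {0..v}"
    by (rule has_integral_mult_right)
  have "((\<lambda>t. t powr (\<alpha> - 1) * max (v - t) 0 powr (\<beta> - 1)) has_integral
      v powr (\<alpha> + \<beta> - 2) * (v * Beta \<alpha> \<beta>)) {0..v}"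
  proof (rule has_integral_eq[OF _ *])
    fix t assume t: "t \<in> {0..v}"
    have 1: "v powr (\<alpha> + \<beta> - 2) = v powr (\<alpha> - 1) * v powr (\<beta> - 1)"
      by (simp add: powr_add[symmetric])
    have 2: "v powr (\<alpha> - 1) * (1 / v * t) powr (\<alpha> - 1) = t powr (\<alpha> - 1)"
      using v t by (simp add: powr_mult[symmetric])
    have 3: "v powr (\<beta> - 1) * (1 - 1 / v * t) powr (\<beta> - 1) = (v - t) powr (\<beta> - 1)"
      using v t by (subst powr_mult[symmetric]) (auto simp: right_diff_distrib)
    have 4: "max (v - t) 0 = v - t" using t by simp
    show "v powr (\<alpha> + \<beta> - 2) * ((1 / v * t) powr (\<alpha> - 1) * (1 - 1 / v * t) powr (\<beta> - 1))
        = t powr (\<alpha> - 1) * max (v - t) 0 powr (\<beta> - 1)"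
      unfolding 1 4 2[symmetric] 3[symmetric] by (simp only: mult_ac)
  qed
  then have "((\<lambda>t. if t \<in> {0..v} then t powr (\<alpha> - 1) * max (v - t) 0 powr (\<beta> - 1) else 0) has_integral
      v powr (\<alpha> + \<beta> - 2) * (v * Beta \<alpha> \<beta>)) {0..T}"
    by (subst has_integral_restrict) (use assms in auto)
  then have "((\<lambda>t. t powr (\<alpha> - 1) * max (v - t) 0 powr (\<beta> - 1)) has_integral
      v powr (\<alpha> + \<beta> - 2) * (v * Beta \<alpha> \<beta>)) {0..T}"
    by (rule has_integral_eq[rotated]) (auto simp: max_def)
  moreover have "v powr (\<alpha> + \<beta> - 2) * v = v powr (\<alpha> + \<beta> - 1)"
    using v powr_add[of v "\<alpha> + \<beta> - 2" 1] by simp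
  ultimately show ?thesis by (simp add: mult.assoc[symmetric])
qed

lemma Gamma_five_halves: "Gamma (5 / 2 :: real) = 3 / 4 * sqrt pi"
proof -
  have "Gamma (3 / 2 :: real) = 1 / 2 * sqrt pi"
    using Gamma_plus1[of "1 / 2 :: real"] Gamma_one_half_real nonpos_Ints_nonpos[of "1/2::real"]
    by auto
  moreover have "(3 / 2 :: real) \<notin> \<int>\<^sub>\<le>\<^sub>0" using nonpos_Ints_nonpos[of "3/2::real"] by auto
  ultimately show ?thesis using Gamma_plus1[of "3 / 2 :: real"] by simp
qed

text \<open>The common factor \<open>Gamma (\<gamma> - 1)\<close> cancels, leaving
  \<open>Gamma (5 / 2)\<close> times the Gamma quotient in \<open>L_cl \<gamma>\<close>. Hence
  integration in \<open>t\<close> turns the constant of \<open>cubic_max\<close> into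
  \<open>pi / sqrt 3 * L_cl \<gamma>\<close> with no further loss.\<close>

lemma Beta_ratio_L_cl:
  assumes "\<gamma> > 1"
  shows "2 / (3 * sqrt 3) * Beta (\<gamma> - 1) (5 / 2) = pi / sqrt 3 * L_cl \<gamma> * Beta (\<gamma> - 1) 2"
proof -
  have G2: "Gamma (2 :: real) = 1" using Gamma_fact[of 1, where 'a = real] by simp
  have pos: "Gamma (\<gamma> + 3 / 2) > 0" "Gamma (\<gamma> + 1) > 0" using assms by auto
  have arg: "\<gamma> - 1 + 5 / 2 = \<gamma> + 3 / 2" "\<gamma> - 1 + 2 = \<gamma> + 1" by simp_all
  have sp: "pi = sqrt pi * sqrt pi" by simp
  show ?thesis
    unfolding Beta_def L_cl_def arg Gamma_five_halves G2
    by (subst sp) (use pos in \<open>simp add: field_simps del: real_sqrt_mult_self\<close>)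
qed

text \<open>For \<open>\<gamma> > 1\<close>, integrating the level inequality against
  \<open>t powr (\<gamma> - 2)\<close> produces the powers of \<open>e i\<close> and
  \<open>v n\<close> with Beta factors. The cutoff \<open>T\<close> lies above all these values, so
  it truncates none of them, and it keeps the integral of the error \<open>\<delta>\<close>
  finite.\<close>

lemma aizenman_lieb:
  fixes e v :: "_ \<Rightarrow> real"
  assumes g: "\<gamma> \<ge> 1" and fin: "finite F" "finite S"
    and e: "\<And>i. i \<in> F \<Longrightarrow> 0 \<le> e i \<and> e i \<le> T" and v: "\<And>n. n \<in> S \<Longrightarrow> 0 \<le> v n \<and> v n \<le> T"
    and T: "T > 0"
    and level: "\<And>t. t \<ge> 0 \<Longrightarrow> (\<Sum>i\<in>F. max (e i - t) 0)
      \<le> (\<Sum>n\<in>S. 2 / (3 * sqrt 3) * max (v n - t) 0 powr (3 / 2)) + \<delta>"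
  shows "(\<Sum>i\<in>F. e i powr \<gamma>) \<le> pi / sqrt 3 * L_cl \<gamma> * (\<Sum>n\<in>S. v n powr (\<gamma> + 1 / 2))
    + \<delta> * (if \<gamma> = 1 then 1 else T powr (\<gamma> - 1) / (\<gamma> - 1) / Beta (\<gamma> - 1) 2)"
proof (cases "\<gamma> = 1")
  case True
  \<comment> \<open>The weight is not integrable at 0 when \<open>\<gamma> = 1\<close>, but there
    the level \<open>t = 0\<close> is already the claim.\<close>
  have "pi / sqrt 3 * L_cl 1 = 2 / (3 * sqrt 3)"
    using Gamma_fact[of 1, where 'a = real] by (simp add: L_cl_def Gamma_five_halves)
  then show ?thesis
    using level[of 0] e v True by (simp add: sum_distrib_left max_absorb1 cong: sum.cong)
next
  case False
  then have g1: "\<gamma> > 1" using g by simp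
  let ?w = "\<lambda>t::real. t powr (\<gamma> - 2)"
  let ?C = "2 / (3 * sqrt 3)"
  have Beta0: "Beta (\<gamma> - 1) 2 > 0" using g1 by (simp add: Beta_def)
  have L: "((\<lambda>t. \<Sum>i\<in>F. ?w t * max (e i - t) 0) has_integral (\<Sum>i\<in>F. e i powr \<gamma> * Beta (\<gamma> - 1) 2)) {0..T}"
  proof (intro has_integral_sum fin)
    fix i assume "i \<in> F"
    then show "((\<lambda>t. ?w t * max (e i - t) 0) has_integral e i powr \<gamma> * Beta (\<gamma> - 1) 2) {0..T}"
      using has_integral_truncated_Beta[of "\<gamma> - 1" 2 "e i" T] g1 e by simp
  qed
  have R: "((\<lambda>t. (\<Sum>n\<in>S. ?C * (?w t * max (v n - t) 0 powr (3 / 2))) + \<delta> * ?w t) has_integral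
      (\<Sum>n\<in>S. ?C * (v n powr (\<gamma> + 1 / 2) * Beta (\<gamma> - 1) (5 / 2))) + \<delta> * (T powr (\<gamma> - 1) / (\<gamma> - 1))) {0..T}"
  proof (intro has_integral_add has_integral_sum has_integral_mult_right fin)
    fix n assume "n \<in> S"
    then show "((\<lambda>t. ?w t * max (v n - t) 0 powr (3 / 2)) has_integral
        v n powr (\<gamma> + 1 / 2) * Beta (\<gamma> - 1) (5 / 2)) {0..T}"
      using has_integral_truncated_Beta[of "\<gamma> - 1" "5 / 2" "v n" T] g1 v by (simp add: add.commute)
  next
    show "(?w has_integral T powr (\<gamma> - 1) / (\<gamma> - 1)) {0..T}"
      using has_integral_powr_from_0[of "\<gamma> - 2" T] g1 T by simp
  qed
  have "(\<Sum>i\<in>F. e i powr \<gamma> * Beta (\<gamma> - 1) 2)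
      \<le> (\<Sum>n\<in>S. ?C * (v n powr (\<gamma> + 1 / 2) * Beta (\<gamma> - 1) (5 / 2))) + \<delta> * (T powr (\<gamma> - 1) / (\<gamma> - 1))"
  proof (rule has_integral_le[OF L R])
    fix t assume "t \<in> {0..T}"
    then have "?w t * (\<Sum>i\<in>F. max (e i - t) 0)
        \<le> ?w t * ((\<Sum>n\<in>S. ?C * max (v n - t) 0 powr (3 / 2)) + \<delta>)"
      by (intro mult_left_mono level) auto
    then show "(\<Sum>i\<in>F. ?w t * max (e i - t) 0)
        \<le> (\<Sum>n\<in>S. ?C * (?w t * max (v n - t) 0 powr (3 / 2))) + \<delta> * ?w t"
      by (simp add: sum_distrib_left distrib_left mult_ac)
  qed
  also have "(\<Sum>n\<in>S. ?C * (v n powr (\<gamma> + 1 / 2) * Beta (\<gamma> - 1) (5 / 2)))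
      = (?C * Beta (\<gamma> - 1) (5 / 2)) * (\<Sum>n\<in>S. v n powr (\<gamma> + 1 / 2))"
    unfolding sum_distrib_left by (intro sum.cong refl) simp
  finally have "(\<Sum>i\<in>F. e i powr \<gamma>) * Beta (\<gamma> - 1) 2
      \<le> pi / sqrt 3 * L_cl \<gamma> * Beta (\<gamma> - 1) 2 * (\<Sum>n\<in>S. v n powr (\<gamma> + 1 / 2))
        + \<delta> * (T powr (\<gamma> - 1) / (\<gamma> - 1))"
    unfolding Beta_ratio_L_cl[OF g1] sum_distrib_right .
  moreover have "x \<le> k * y + d * (c / B)" if "x * B \<le> k * B * y + d * c" "B > 0"
    for x k y d c B :: real
    using that by (simp add: field_simps)
  ultimately have "(\<Sum>i\<in>F. e i powr \<gamma>) \<le> pi / sqrt 3 * L_cl \<gamma> * (\<Sum>n\<in>S. v n powr (\<gamma> + 1 / 2))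
      + \<delta> * (T powr (\<gamma> - 1) / (\<gamma> - 1) / Beta (\<gamma> - 1) 2)"
    using Beta0 by blast
  then show ?thesis using False by simp
qed

section \<open>The bound for finitely many eigenvalues above 2\<close>

lemma L_cl_nonneg: "\<gamma> \<ge> 1 \<Longrightarrow> L_cl \<gamma> \<ge> 0"
  by (simp add: L_cl_def less_imp_le)

text \<open>The coefficients and \<open>E\<close> are real, so the real and imaginary parts of a
  complex eigenvector solve the same equation, and at least one of them is nonzero. This justifies
  working with real sequences throughout.\<close>

lemma normalized_eigenfunction_exists:
  assumes "jacobi_eigenvalue a b E"
  obtains \<psi> where "eigenfunction a b E \<psi>" "ip \<psi> \<psi> = 1"
proof -
  obtain u where u: "ell2_int u" "u \<noteq> (\<lambda>_. 0)" "\<And>n. jacobi_op a b u n = of_real E * u n"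
    using assms by (auto simp: jacobi_eigenvalue_def)
  have sq: "(Re z)\<^sup>2 \<le> (cmod z)\<^sup>2" "(Im z)\<^sup>2 \<le> (cmod z)\<^sup>2" for z
    by (simp_all add: cmod_power2)
  have "l2 (\<lambda>n. Re (u n))" "l2 (\<lambda>n. Im (u n))"
    using u(1) unfolding l2_def ell2_int_def
    by (auto elim!: summable_on_comparison_test simp: sq)
  moreover have "a (n - 1) * Re (u (n - 1)) + b n * Re (u n) + a n * Re (u (n + 1)) = E * Re (u n)"
    "a (n - 1) * Im (u (n - 1)) + b n * Im (u n) + a n * Im (u (n + 1)) = E * Im (u n)" for n
    using arg_cong[OF u(3)[of n], of Re] arg_cong[OF u(3)[of n], of Im]
    by (simp_all add: jacobi_op_def)
  ultimately have "eigenfunction a b E (\<lambda>n. Re (u n))" "eigenfunction a b E (\<lambda>n. Im (u n))"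
    by (auto simp: eigenfunction_def)
  moreover obtain n where "Re (u n) \<noteq> 0 \<or> Im (u n) \<noteq> 0"
    using u(2) by (auto simp: fun_eq_iff complex_eq_iff)
  ultimately obtain w where w: "eigenfunction a b E w" "w n \<noteq> 0" by blast
  then have l2w: "l2 w" by (simp add: eigenfunction_def)
  have "(\<Sum>k\<in>{n}. w k * w k) \<le> ip w w"
    unfolding ip_def using l2_mult_summable[OF l2w l2w] by (intro finite_sum_le_infsum) auto
  moreover have "w n * w n > 0" using w(2) not_real_square_gt_zero by blast
  ultimately have pos: "ip w w > 0" by simp
  define c where "c = 1 / sqrt (ip w w)"
  have "((\<lambda>k. (c * w k) * (c * w k)) has_sum (c * c * ip w w)) UNIV"
    using has_sum_cmult_right[OF l2_mult_has_sum[OF l2w l2w], of "c * c"] by (simp add: mult_ac)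
  then have "ip (\<lambda>k. c * w k) (\<lambda>k. c * w k) = c * c * ip w w" by (rule ip_eqI)
  also have "\<dots> = 1" using pos by (simp add: c_def)
  finally have "ip (\<lambda>k. c * w k) (\<lambda>k. c * w k) = 1" .
  moreover have "eigenfunction a b E (\<lambda>k. c * w k)"
    unfolding eigenfunction_def
  proof (intro conjI allI)
    show "l2 (\<lambda>k. c * w k)" using l2w by (rule l2_scale)
    fix n
    have "a (n - 1) * w (n - 1) + b n * w n + a n * w (n + 1) = E * w n"
      using w(1) by (simp add: eigenfunction_def)
    from arg_cong[OF this, of "\<lambda>x. c * x"]
    show "a (n - 1) * (c * w (n - 1)) + b n * (c * w n) + a n * (c * w (n + 1)) = E * (c * w n)"
      by (simp add: algebra_simps)
  qed
  ultimately show ?thesis using that by blast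
qed

lemma finite_eigenvalue_sum_le:
  assumes g: "\<gamma> \<ge> 1" and fin: "finite F"
    and F: "\<And>E. E \<in> F \<Longrightarrow> E > 2 \<and> jacobi_eigenvalue a b E"
    and a: "\<And>n. \<bar>a n - 1\<bar> \<le> K" and b: "\<And>n. \<bar>b n\<bar> \<le> K"
    and V: "(\<lambda>n. majorant a b n powr (\<gamma> + 1 / 2)) summable_on UNIV"
  shows "(\<Sum>E\<in>F. \<bar>E - 2\<bar> powr \<gamma>)
    \<le> pi / sqrt 3 * L_cl \<gamma> * (\<Sum>\<^sub>\<infinity>n. majorant a b n powr (\<gamma> + 1 / 2))"
proof -
  have "\<exists>\<psi>. \<forall>E\<in>F. eigenfunction a b E (\<psi> E) \<and> ip (\<psi> E) (\<psi> E) = 1"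
  proof (rule bchoice, rule ballI)
    fix E assume "E \<in> F"
    then show "\<exists>\<psi>. eigenfunction a b E \<psi> \<and> ip \<psi> \<psi> = 1"
      using F normalized_eigenfunction_exists[of a b E] by blast
  qed
  then obtain \<psi> where \<psi>: "\<And>E. E \<in> F \<Longrightarrow> eigenfunction a b E (\<psi> E)"
    "\<And>E. E \<in> F \<Longrightarrow> ip (\<psi> E) (\<psi> E) = 1" by blast
  define Y where "Y n = majorant a b n * (\<Sum>E\<in>F. (\<psi> E n)\<^sup>2)" for n
  have K0: "K \<ge> 0" using a[of 0] by linarith
  have VK: "majorant a b n \<le> 3 * K" for n
    using a[of n] a[of "n - 1"] b[of n] by (simp add: majorant_def)
  have VK': "\<bar>majorant a b n\<bar> \<le> 3 * K" for n
    using VK[of n] majorant_nonneg[of a b n] by simp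
  have Y: "Y summable_on UNIV"
  proof -
    have "((\<lambda>n. majorant a b n * (\<psi> E n)\<^sup>2) has_sum (\<Sum>\<^sub>\<infinity>n. majorant a b n * (\<psi> E n)\<^sup>2)) UNIV"
      if "E \<in> F" for E
      unfolding power2_eq_square using \<psi>(1)[OF that]
      by (intro has_sum_infsum l2_weighted_summable[where w = "majorant a b", OF _ _ VK'])
        (auto simp: eigenfunction_def)
    then show ?thesis unfolding Y_def sum_distrib_left
      by (intro has_sum_imp_summable[OF has_sum_sum] fin)
  qed
  \<comment> \<open>\<open>3 * K\<close> dominates the majorant and the sum of the nonnegative
    excesses dominates each of them; the final 1 makes \<open>T\<close> positive.\<close>
  define T where "T = 3 * K + (\<Sum>E\<in>F. E - 2) + 1"
  have sum0: "(\<Sum>E\<in>F. E - 2) \<ge> 0" using F by (intro sum_nonneg) (auto simp: less_imp_le)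
  have eT: "0 \<le> E - 2 \<and> E - 2 \<le> T" if "E \<in> F" for E
  proof -
    have "E - 2 \<le> (\<Sum>E\<in>F. E - 2)"
      using that fin F by (intro member_le_sum) (auto simp: less_imp_le)
    then show ?thesis using F[OF that] K0 by (auto simp: T_def)
  qed
  have vT: "0 \<le> majorant a b n \<and> majorant a b n \<le> T" for n
    using majorant_nonneg[of a b n] VK[of n] sum0 by (simp add: T_def)
  have T0: "T > 0" using K0 sum0 by (simp add: T_def)
  define M where "M = (if \<gamma> = 1 then 1 else T powr (\<gamma> - 1) / (\<gamma> - 1) / Beta (\<gamma> - 1) 2)"
  have M0: "M > 0" using g T0 by (auto simp: M_def Beta_def)
  have "(\<Sum>E\<in>F. (E - 2) powr \<gamma>)
      \<le> pi / sqrt 3 * L_cl \<gamma> * (\<Sum>\<^sub>\<infinity>n. majorant a b n powr (\<gamma> + 1 / 2)) + d" if d: "d > 0" for d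
  proof -
    \<comment> \<open>\<open>M\<close> is the factor by which \<open>aizenman_lieb\<close>
      multiplies the error, so a tail of at most \<open>d / M\<close> contributes at most
      \<open>d\<close>. The set \<open>S\<close> depends on \<open>d\<close>, but the final bound
      does not.\<close>
    have "d / M > 0" using d M0 by simp
    then obtain S where S: "finite S" "dist (sum Y S) (infsum Y UNIV) \<le> d / M"
      using infsum_finite_approximation[OF Y] by blast
    have "infsum Y UNIV = infsum Y (S \<union> - S)" by simp
    also have "\<dots> = sum Y S + infsum Y (- S)"
      using S Y summable_on_subset[OF Y] by (subst infsum_Un_disjoint) auto
    finally have tail: "infsum Y (- S) \<le> d / M" using S(2) by (simp add: dist_real_def)
    have "(\<Sum>E\<in>F. (E - 2) powr \<gamma>) \<le> pi / sqrt 3 * L_cl \<gamma> * (\<Sum>n\<in>S. majorant a b n powr (\<gamma> + 1 / 2))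
        + infsum Y (- S) * M"
      unfolding M_def
    proof (rule aizenman_lieb[OF g fin S(1) eT vT T0])
      fix t :: real assume "t \<ge> 0"
      then show "(\<Sum>E\<in>F. max (E - 2 - t) 0)
          \<le> (\<Sum>n\<in>S. 2 / (3 * sqrt 3) * max (majorant a b n - t) 0 powr (3 / 2)) + infsum Y (- S)"
        unfolding Y_def using eigenvalue_level_bound[OF fin \<psi> a b _ S(1)] by blast
    qed
    also have "\<dots> \<le> pi / sqrt 3 * L_cl \<gamma> * (\<Sum>\<^sub>\<infinity>n. majorant a b n powr (\<gamma> + 1 / 2)) + d / M * M"
      using tail M0 d L_cl_nonneg[OF g] S(1) V
      by (intro add_mono mult_mono finite_sum_le_infsum) (auto intro!: sum_nonneg mult_nonneg_nonneg)
    finally show ?thesis using M0 by simp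
  qed
  then have "(\<Sum>E\<in>F. (E - 2) powr \<gamma>)
      \<le> pi / sqrt 3 * L_cl \<gamma> * (\<Sum>\<^sub>\<infinity>n. majorant a b n powr (\<gamma> + 1 / 2))"
    by (rule field_le_epsilon)
  moreover have "(\<Sum>E\<in>F. \<bar>E - 2\<bar> powr \<gamma>) = (\<Sum>E\<in>F. (E - 2) powr \<gamma>)"
    using F by (intro sum.cong refl) (simp add: abs_of_pos)
  ultimately show ?thesis by simp
qed

section \<open>Convexity of powers and the power sums of the majorant\<close>

lemma convex_on_powr_nonneg:
  assumes "p \<ge> 1"
  shows "convex_on {0..} (\<lambda>x::real. x powr p)"
proof (rule convex_on_linorderI)
  fix t x y :: real
  assume t: "0 < t" "t < 1" and xy: "x \<in> {0..}" "y \<in> {0..}" "x < y"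
  show "((1 - t) *\<^sub>R x + t *\<^sub>R y) powr p \<le> (1 - t) * x powr p + t * y powr p"
  proof (cases "x = 0")
    case True
    \<comment> \<open>At the endpoint 0 convexity reduces to t^p \<le> t on the unit
      interval.\<close>
    have "t powr p \<le> t powr 1" using t assms by (intro powr_mono') auto
    then have "t powr p * y powr p \<le> t * y powr p" using t by (intro mult_right_mono) auto
    then show ?thesis using True t xy by (simp add: powr_mult)
  next
    case False
    then show ?thesis using convex_onD[OF powr_convex[OF assms], of t x y] t xy by simp
  qed
qed simp

text \<open>Jensen's inequality with three equal weights. With \<open>p = \<gamma> + 1/2\<close>
  this is the source of the factor \<open>3 powr (\<gamma> - 1/2)\<close>.\<close>

lemma powr_sum3_le:
  fixes x y z p :: real
  assumes "p \<ge> 1" "x \<ge> 0" "y \<ge> 0" "z \<ge> 0"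
  shows "(x + y + z) powr p \<le> 3 powr (p - 1) * (x powr p + y powr p + z powr p)"
proof -
  define f where "f i = (if i = 0 then x else if i = 1 then y else z)" for i :: nat
  have "(\<Sum>i\<in>{0,1,2}. (1/3) *\<^sub>R f i) powr p \<le> (\<Sum>i\<in>{0,1,2}. 1/3 * f i powr p)"
    using assms by (intro convex_on_sum[OF _ _ convex_on_powr_nonneg[OF assms(1)]]) (auto simp: f_def)
  then have "((x + y + z) / 3) powr p \<le> (x powr p + y powr p + z powr p) / 3"
    by (simp add: f_def add_divide_distrib add.assoc)
  then have "3 powr p * ((x + y + z) / 3) powr p \<le> 3 powr p * ((x powr p + y powr p + z powr p) / 3)"
    by (rule mult_left_mono) simp
  also have "3 powr p * ((x + y + z) / 3) powr p = (x + y + z) powr p"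
    using assms by (simp add: powr_divide)
  also have "3 powr p * ((x powr p + y powr p + z powr p) / 3)
      = 3 powr (p - 1) * (x powr p + y powr p + z powr p)"
    by (simp add: powr_diff)
  finally show ?thesis .
qed

lemma powr_summable_imp_bounded:
  fixes f :: "int \<Rightarrow> real"
  assumes "(\<lambda>n. \<bar>f n\<bar> powr p) summable_on UNIV" "p \<ge> 1"
  obtains K where "\<And>n. \<bar>f n\<bar> \<le> K"
proof
  fix n
  have "\<bar>f n\<bar> powr p \<le> (\<Sum>\<^sub>\<infinity>n. \<bar>f n\<bar> powr p)"
    using finite_sum_le_infsum[OF assms(1), of "{n}"] by simp
  moreover have "\<bar>f n\<bar> \<le> 1 + \<bar>f n\<bar> powr p"
  proof (cases "\<bar>f n\<bar> \<le> 1")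
    case False
    then have "\<bar>f n\<bar> powr 1 \<le> \<bar>f n\<bar> powr p" using assms(2) by (intro powr_mono) auto
    then show ?thesis by simp
  qed (simp add: add_increasing2)
  ultimately show "\<bar>f n\<bar> \<le> 1 + (\<Sum>\<^sub>\<infinity>n. \<bar>f n\<bar> powr p)" by linarith
qed

text \<open>The two bond terms at a site have equal sums by translation, hence the factor 2. Keeping
  only the positive part of \<open>b\<close> lets the two ends of the spectrum share the sum over
  \<open>b\<close> later.\<close>

lemma majorant_powr_sum_le:
  assumes p: "p \<ge> 1"
    and b: "(\<lambda>n. \<bar>b n\<bar> powr p) summable_on UNIV"
    and a: "(\<lambda>n. \<bar>a n - 1\<bar> powr p) summable_on UNIV"
  shows "(\<lambda>n. majorant a b n powr p) summable_on UNIV"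
    and "(\<Sum>\<^sub>\<infinity>n. majorant a b n powr p)
      \<le> 3 powr (p - 1) * ((\<Sum>\<^sub>\<infinity>n. max (b n) 0 powr p) + 2 * (\<Sum>\<^sub>\<infinity>n. \<bar>a n - 1\<bar> powr p))"
proof -
  have "max (b n) 0 powr p \<le> \<bar>b n\<bar> powr p" for n using p by (intro powr_mono2) auto
  then have "(\<lambda>n. max (b n) 0 powr p) summable_on UNIV"
    by (intro summable_on_comparison_test[OF b]) auto
  note B = has_sum_infsum[OF this] and A = has_sum_infsum[OF a]
  have A': "((\<lambda>n. \<bar>a (n - 1) - 1\<bar> powr p) has_sum (\<Sum>\<^sub>\<infinity>n. \<bar>a n - 1\<bar> powr p)) UNIV"
    using A has_sum_shift[of "\<lambda>n. \<bar>a n - 1\<bar> powr p" "-1"] by simp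
  have R: "((\<lambda>n. 3 powr (p - 1) * (max (b n) 0 powr p + \<bar>a n - 1\<bar> powr p + \<bar>a (n - 1) - 1\<bar> powr p))
      has_sum 3 powr (p - 1) * ((\<Sum>\<^sub>\<infinity>n. max (b n) 0 powr p) + (\<Sum>\<^sub>\<infinity>n. \<bar>a n - 1\<bar> powr p)
        + (\<Sum>\<^sub>\<infinity>n. \<bar>a n - 1\<bar> powr p))) UNIV"
    by (intro has_sum_cmult_right has_sum_add A A' B)
  have le: "majorant a b n powr p
      \<le> 3 powr (p - 1) * (max (b n) 0 powr p + \<bar>a n - 1\<bar> powr p + \<bar>a (n - 1) - 1\<bar> powr p)" for n
    unfolding majorant_def by (rule powr_sum3_le[OF p]) auto
  show sm: "(\<lambda>n. majorant a b n powr p) summable_on UNIV"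
    by (rule summable_on_comparison_test[OF has_sum_imp_summable[OF R] le]) auto
  show "(\<Sum>\<^sub>\<infinity>n. majorant a b n powr p)
      \<le> 3 powr (p - 1) * ((\<Sum>\<^sub>\<infinity>n. max (b n) 0 powr p) + 2 * (\<Sum>\<^sub>\<infinity>n. \<bar>a n - 1\<bar> powr p))"
    using has_sum_mono[OF has_sum_infsum[OF sm] R le] by (simp add: add.assoc)
qed

section \<open>All eigenvalues, at both ends of the spectrum\<close>

lemma positive_eigenvalue_sum_le:
  assumes g: "\<gamma> \<ge> 1"
    and b: "(\<lambda>n. \<bar>b n\<bar> powr (\<gamma> + 1/2)) summable_on UNIV"
    and a: "(\<lambda>n. \<bar>a n - 1\<bar> powr (\<gamma> + 1/2)) summable_on UNIV"
  defines "P \<equiv> {E. E > 2 \<and> jacobi_eigenvalue a b E}"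
  shows "(\<lambda>E. \<bar>E - 2\<bar> powr \<gamma>) summable_on P"
    and "(\<Sum>\<^sub>\<infinity>E\<in>P. \<bar>E - 2\<bar> powr \<gamma>) \<le> 3 powr (\<gamma> - 1/2) * (pi / sqrt 3) * L_cl \<gamma> *
      ((\<Sum>\<^sub>\<infinity>n. max (b n) 0 powr (\<gamma> + 1/2)) + 2 * (\<Sum>\<^sub>\<infinity>n. \<bar>a n - 1\<bar> powr (\<gamma> + 1/2)))"
    (is "_ \<le> ?B")
proof -
  have p: "\<gamma> + 1/2 \<ge> 1" using g by simp
  obtain K1 where K1: "\<And>n. \<bar>b n\<bar> \<le> K1" using powr_summable_imp_bounded[OF b p] by blast
  obtain K2 where K2: "\<And>n. \<bar>a n - 1\<bar> \<le> K2"
    using powr_summable_imp_bounded[of "\<lambda>n. a n - 1", OF a p] by blast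
  have K: "\<bar>b n\<bar> \<le> max K1 K2" "\<bar>a n - 1\<bar> \<le> max K1 K2" for n
    using K1[of n] K2[of n] by auto
  note V = majorant_powr_sum_le[OF p b a]
  \<comment> \<open>A bound uniform over finite sets of eigenvalues yields both summability and the
    estimate of the full sum, without enumerating the eigenvalues.\<close>
  have fin: "(\<Sum>E\<in>F. \<bar>E - 2\<bar> powr \<gamma>) \<le> ?B" if "finite F" "F \<subseteq> P" for F
  proof -
    have "(\<Sum>E\<in>F. \<bar>E - 2\<bar> powr \<gamma>)
        \<le> pi / sqrt 3 * L_cl \<gamma> * (\<Sum>\<^sub>\<infinity>n. majorant a b n powr (\<gamma> + 1 / 2))"
      using that K by (intro finite_eigenvalue_sum_le[OF g _ _ _ _ V(1)]) (auto simp: P_def)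
    also have "\<dots> \<le> pi / sqrt 3 * L_cl \<gamma> * (3 powr (\<gamma> + 1/2 - 1) *
        ((\<Sum>\<^sub>\<infinity>n. max (b n) 0 powr (\<gamma> + 1/2)) + 2 * (\<Sum>\<^sub>\<infinity>n. \<bar>a n - 1\<bar> powr (\<gamma> + 1/2))))"
      using L_cl_nonneg[OF g] by (intro mult_left_mono V(2)) auto
    also have "\<dots> = ?B" by (simp add: mult_ac)
    finally show ?thesis .
  qed
  show sm: "(\<lambda>E. \<bar>E - 2\<bar> powr \<gamma>) summable_on P"
    by (rule nonneg_bdd_above_summable_on) (auto intro!: bdd_aboveI2[where M = ?B] fin)
  show "(\<Sum>\<^sub>\<infinity>E\<in>P. \<bar>E - 2\<bar> powr \<gamma>) \<le> ?B" by (rule infsum_le_finite_sums[OF sm fin])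
qed

lemma jacobi_eigenvalue_reflect_imp:
  assumes "jacobi_eigenvalue a b E"
  shows "jacobi_eigenvalue a (\<lambda>n. - b n) (- E)"
proof -
  obtain u where u: "ell2_int u" "u \<noteq> (\<lambda>_. 0)" "\<And>n. jacobi_op a b u n = of_real E * u n"
    using assms by (auto simp: jacobi_eigenvalue_def)
  define s where "s n = (if even n then 1 else - 1 :: complex)" for n :: int
  define w where "w n = s n * u n" for n
  have "norm (s n) = 1" for n by (simp add: s_def)
  then have "ell2_int w" using u(1) by (simp add: ell2_int_def w_def norm_mult)
  moreover have "w \<noteq> (\<lambda>_. 0)"
  proof -
    obtain n where "u n \<noteq> 0" using u(2) by auto
    then have "w n \<noteq> 0" by (simp add: w_def s_def)
    then show ?thesis by auto
  qed
  moreover have "jacobi_op a (\<lambda>n. - b n) w n = of_real (- E) * w n" for n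
  proof -
    \<comment> \<open>The alternating sign anticommutes with hopping to a neighbour, and the sign
      change of \<open>b\<close> makes the diagonal term match.\<close>
    have "s (n - 1) = - s n" "s (n + 1) = - s n" by (simp_all add: s_def)
    then have "jacobi_op a (\<lambda>n. - b n) w n = - s n * jacobi_op a b u n"
      by (simp add: jacobi_op_def w_def algebra_simps)
    then show ?thesis by (simp add: u(3) w_def)
  qed
  ultimately show ?thesis by (auto simp: jacobi_eigenvalue_def)
qed

lemma jacobi_eigenvalue_reflect:
  "jacobi_eigenvalue a (\<lambda>n. - b n) (- E) \<longleftrightarrow> jacobi_eigenvalue a b E"
  using jacobi_eigenvalue_reflect_imp[of a b E]
    jacobi_eigenvalue_reflect_imp[of a "\<lambda>n. - b n" "- E"] by auto

theorem theorem1p5: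
  fixes \<gamma> :: real and a b :: "int \<Rightarrow> real"
  assumes "\<gamma> \<ge> 1"
    and "\<And>n. a n > 0"
    and "(\<lambda>n. \<bar>b n\<bar> powr (\<gamma> + 1/2)) summable_on UNIV"
    and "(\<lambda>n. \<bar>a n - 1\<bar> powr (\<gamma> + 1/2)) summable_on UNIV"
  shows "(\<lambda>E. \<bar>E + 2\<bar> powr \<gamma>) summable_on {E. E < -2 \<and> jacobi_eigenvalue a b E}
    \<and> (\<lambda>E. \<bar>E - 2\<bar> powr \<gamma>) summable_on {E. E > 2 \<and> jacobi_eigenvalue a b E}
    \<and> (\<Sum>\<^sub>\<infinity>E\<in>{E. E < -2 \<and> jacobi_eigenvalue a b E}. \<bar>E + 2\<bar> powr \<gamma>)
      + (\<Sum>\<^sub>\<infinity>E\<in>{E. E > 2 \<and> jacobi_eigenvalue a b E}. \<bar>E - 2\<bar> powr \<gamma>)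
      \<le> 3 powr (\<gamma> - 1/2) * (pi / sqrt 3) * L_cl \<gamma> *
         ((\<Sum>\<^sub>\<infinity>n. \<bar>b n\<bar> powr (\<gamma> + 1/2)) + 4 * (\<Sum>\<^sub>\<infinity>n. \<bar>a n - 1\<bar> powr (\<gamma> + 1/2)))"
proof -
  define p where "p = \<gamma> + 1/2"
  define C where "C = 3 powr (\<gamma> - 1/2) * (pi / sqrt 3) * L_cl \<gamma>"
  define A where "A = (\<Sum>\<^sub>\<infinity>n. \<bar>a n - 1\<bar> powr p)"
  define N where "N = {E. E < -2 \<and> jacobi_eigenvalue a b E}"
  define N' where "N' = {E. E > 2 \<and> jacobi_eigenvalue a (\<lambda>n. - b n) E}"
  define P where "P = {E. E > 2 \<and> jacobi_eigenvalue a b E}"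
  note pos = positive_eigenvalue_sum_le[OF assms(1,3,4), folded P_def p_def C_def, folded A_def]
  have b': "(\<lambda>n. \<bar>- b n\<bar> powr (\<gamma> + 1/2)) summable_on UNIV" using assms(3) by simp
  note neg = positive_eigenvalue_sum_le[OF assms(1) b' assms(4), folded N'_def p_def C_def, folded A_def]
  have bij: "bij_betw uminus N N'"
    by (rule bij_betwI[where g = uminus])
      (auto simp: N_def N'_def jacobi_eigenvalue_reflect
        intro: jacobi_eigenvalue_reflect[of a b "- _", simplified, THEN iffD1])
  have flip: "\<bar>- E - 2\<bar> = \<bar>E + 2\<bar>" for E :: real by linarith
  have smN: "(\<lambda>E. \<bar>E + 2\<bar> powr \<gamma>) summable_on N"
    using neg(1) summable_on_reindex_bij_betw[OF bij, of "\<lambda>E. \<bar>E - 2\<bar> powr \<gamma>"] by (simp add: flip)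
  have eqN: "(\<Sum>\<^sub>\<infinity>E\<in>N. \<bar>E + 2\<bar> powr \<gamma>) = (\<Sum>\<^sub>\<infinity>E\<in>N'. \<bar>E - 2\<bar> powr \<gamma>)"
    using infsum_reindex_bij_betw[OF bij, of "\<lambda>E. \<bar>E - 2\<bar> powr \<gamma>"] by (simp add: flip)
  have p0: "p > 0" using assms(1) by (simp add: p_def)
  have bs: "(\<lambda>n. \<bar>b n\<bar> powr p) summable_on UNIV" using assms(3) by (simp add: p_def)
  have B1: "(\<lambda>n. max (b n) 0 powr p) summable_on UNIV" and B2: "(\<lambda>n. max (- b n) 0 powr p) summable_on UNIV"
    by (rule summable_on_comparison_test[OF bs]; use p0 in \<open>auto intro!: powr_mono2\<close>)+
  \<comment> \<open>At each site at most one of the two positive parts is nonzero, so the two ends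
    together use the sum over \<open>b\<close> only once, while each contributes
    \<open>2 * A\<close>, which gives the 4.\<close>
  have "max (b n) 0 powr p + max (- b n) 0 powr p = \<bar>b n\<bar> powr p" for n
    using p0 by (cases "b n \<ge> 0") (auto simp: max_def)
  then have B: "(\<Sum>\<^sub>\<infinity>n. \<bar>b n\<bar> powr p)
      = (\<Sum>\<^sub>\<infinity>n. max (b n) 0 powr p) + (\<Sum>\<^sub>\<infinity>n. max (- b n) 0 powr p)"
    using infsum_add[OF B1 B2] by simp
  have "(\<Sum>\<^sub>\<infinity>E\<in>N. \<bar>E + 2\<bar> powr \<gamma>) + (\<Sum>\<^sub>\<infinity>E\<in>P. \<bar>E - 2\<bar> powr \<gamma>)
      \<le> C * ((\<Sum>\<^sub>\<infinity>n. \<bar>b n\<bar> powr p) + 4 * A)"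
    using pos(2) neg(2) unfolding eqN B by (simp add: algebra_simps)
  then show ?thesis
    using smN pos(1) by (simp add: N_def P_def C_def A_def p_def)
qed

end
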